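(* Let $\mathcal{C}$ be a right exact category. Let $i:A\to B$ and $i':A'\to B'$ be inflations and let $f:A\to A'$, $g:B\to B'$ be morphisms in $\mathcal{C}$ with $gi=i'f$. Then the commutative square formed by $i,i',f,g$ is a pushout (of $i$ and $f$) if and only if it is part of a commutative diagram whose rows are conflations of the form $$A\xrightarrow{i}B\xrightarrow{d}C,\qquad A'\xrightarrow{i'}B'\xrightarrow{d'}C,$$ with vertical morphisms $f:A\to A'$, $g:B\to B'$ and $1_C:C\to C$ (so $gi=i'f$ and $d'g=d$).
   Context: A right exact category is an additive category endowed with a distinguished class of kernels (morphisms that are kernels of some morphism), called inflations, such that: [R0] the identity morphism $1_0:0\to 0$ is an inflation; [R1] the composition of any two inflations is an inflation; [R2] the pushout of any inflation along an arbitrary morphism exists and is again an inflation. By [R2] (pushout along $A\to 0$), every inflation $i:A\to B$ has a cokernel $d:B\to C$; such a $d$ is called a deflation, and $A\xrightarrow{i}B\xrightarrow{d}C$ (which is a kernel-cokernel pair) is called a conflation. *)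

theory Defs
  imports "HOL-Algebra.Group"
begin

record ('o, 'm) category =
  Obj :: "'o set"
  Arr :: "'m set"
  Dom :: "'m \<Rightarrow> 'o"
  Cod :: "'m \<Rightarrow> 'o"
  Ident :: "'o \<Rightarrow> 'm"
  Comp :: "'m \<Rightarrow> 'm \<Rightarrow> 'm"  (infixl "\<cdot>\<index>" 70)

definition Hom :: "('o, 'm, 'z) category_scheme \<Rightarrow> 'o \<Rightarrow> 'o \<Rightarrow> 'm set" where
  "Hom C A B = {f \<in> Arr C. Dom C f = A \<and> Cod C f = B}"

text \<open>Composition is written in the usual order: \<open>g \<cdot> f\<close> is first \<open>f\<close>, then \<open>g\<close>.
  Values of the operations outside the carriers are unconstrained.\<close>

locale category =
  fixes C :: "('o, 'm, 'z) category_scheme" (structure)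
  assumes Dom_closed: "f \<in> Arr C \<Longrightarrow> Dom C f \<in> Obj C"
    and Cod_closed: "f \<in> Arr C \<Longrightarrow> Cod C f \<in> Obj C"
    and Ident_closed: "A \<in> Obj C \<Longrightarrow> Ident C A \<in> Hom C A A"
    and Comp_closed: "f \<in> Hom C X Y \<Longrightarrow> g \<in> Hom C Y Z \<Longrightarrow> g \<cdot> f \<in> Hom C X Z"
    and Comp_assoc:
      "f \<in> Hom C W X \<Longrightarrow> g \<in> Hom C X Y \<Longrightarrow> h \<in> Hom C Y Z \<Longrightarrow> (h \<cdot> g) \<cdot> f = h \<cdot> (g \<cdot> f)"
    and Comp_Ident_left: "f \<in> Hom C X Y \<Longrightarrow> Ident C Y \<cdot> f = f"
    and Comp_Ident_right: "f \<in> Hom C X Y \<Longrightarrow> f \<cdot> Ident C X = f"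

definition zero_object :: "('o, 'm, 'z) category_scheme \<Rightarrow> 'o \<Rightarrow> bool" where
  "zero_object C Z \<longleftrightarrow>
    Z \<in> Obj C \<and> (\<forall>X\<in>Obj C. (\<exists>!f. f \<in> Hom C X Z) \<and> (\<exists>!f. f \<in> Hom C Z X))"

text \<open>\<open>pushout C i f g j\<close>: in the square \<open>g \<cdot> i = j \<cdot> f\<close>, the cospan \<open>(g, j)\<close> is a pushout
  of the span \<open>(i, f)\<close>; the arrow \<open>j\<close> opposite to \<open>i\<close> is the pushout of \<open>i\<close> along \<open>f\<close>.\<close>

definition pushout :: "('o, 'm, 'z) category_scheme \<Rightarrow> 'm \<Rightarrow> 'm \<Rightarrow> 'm \<Rightarrow> 'm \<Rightarrow> bool" where
  "pushout C i f g j \<longleftrightarrow>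
    i \<in> Arr C \<and> f \<in> Arr C \<and> g \<in> Arr C \<and> j \<in> Arr C \<and>
    Dom C i = Dom C f \<and> Dom C g = Cod C i \<and> Dom C j = Cod C f \<and> Cod C g = Cod C j \<and>
    g \<cdot>\<^bsub>C\<^esub> i = j \<cdot>\<^bsub>C\<^esub> f \<and>
    (\<forall>X\<in>Obj C. \<forall>u\<in>Hom C (Cod C i) X. \<forall>v\<in>Hom C (Cod C f) X.
      u \<cdot>\<^bsub>C\<^esub> i = v \<cdot>\<^bsub>C\<^esub> f \<longrightarrow>
      (\<exists>!w. w \<in> Hom C (Cod C g) X \<and> w \<cdot>\<^bsub>C\<^esub> g = u \<and> w \<cdot>\<^bsub>C\<^esub> j = v))"

record ('o, 'm) preadditive_category = "('o, 'm) category" +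
  Add :: "'m \<Rightarrow> 'm \<Rightarrow> 'm"
  Zero :: "'o \<Rightarrow> 'o \<Rightarrow> 'm"

definition Hom_group ::
    "('o, 'm, 'z) preadditive_category_scheme \<Rightarrow> 'o \<Rightarrow> 'o \<Rightarrow> 'm monoid" where
  "Hom_group C A B = \<lparr>carrier = Hom C A B, mult = Add C, one = Zero C A B\<rparr>"

locale preadditive_category = category C
  for C :: "('o, 'm, 'z) preadditive_category_scheme" (structure) +
  assumes Hom_comm_group:
      "A \<in> Obj C \<Longrightarrow> B \<in> Obj C \<Longrightarrow> comm_group (Hom_group C A B)"
    and Comp_Add_left:
      "f \<in> Hom C X Y \<Longrightarrow> g \<in> Hom C Y Z \<Longrightarrow> h \<in> Hom C Y Z \<Longrightarrow>
        Add C g h \<cdot> f = Add C (g \<cdot> f) (h \<cdot> f)"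
    and Comp_Add_right:
      "f \<in> Hom C X Y \<Longrightarrow> g \<in> Hom C X Y \<Longrightarrow> h \<in> Hom C Y Z \<Longrightarrow>
        h \<cdot> Add C f g = Add C (h \<cdot> f) (h \<cdot> g)"

definition biproduct ::
    "('o, 'm, 'z) preadditive_category_scheme \<Rightarrow> 'o \<Rightarrow> 'o \<Rightarrow> 'o \<Rightarrow> 'm \<Rightarrow> 'm \<Rightarrow> 'm \<Rightarrow> 'm \<Rightarrow> bool"
  where
  "biproduct C A B S j\<^sub>A j\<^sub>B p\<^sub>A p\<^sub>B \<longleftrightarrow>
    j\<^sub>A \<in> Hom C A S \<and> j\<^sub>B \<in> Hom C B S \<and> p\<^sub>A \<in> Hom C S A \<and> p\<^sub>B \<in> Hom C S B \<and>
    p\<^sub>A \<cdot>\<^bsub>C\<^esub> j\<^sub>A = Ident C A \<and> p\<^sub>B \<cdot>\<^bsub>C\<^esub> j\<^sub>B = Ident C B \<and>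
    p\<^sub>A \<cdot>\<^bsub>C\<^esub> j\<^sub>B = Zero C B A \<and> p\<^sub>B \<cdot>\<^bsub>C\<^esub> j\<^sub>A = Zero C A B \<and>
    Add C (j\<^sub>A \<cdot>\<^bsub>C\<^esub> p\<^sub>A) (j\<^sub>B \<cdot>\<^bsub>C\<^esub> p\<^sub>B) = Ident C S"

locale additive_category = preadditive_category C
  for C :: "('o, 'm, 'z) preadditive_category_scheme" (structure) +
  assumes zero_object_exists: "\<exists>Z. zero_object C Z"
    and biproduct_exists:
      "A \<in> Obj C \<Longrightarrow> B \<in> Obj C \<Longrightarrow>
        \<exists>S\<in>Obj C. \<exists>j\<^sub>A j\<^sub>B p\<^sub>A p\<^sub>B. biproduct C A B S j\<^sub>A j\<^sub>B p\<^sub>A p\<^sub>B"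

definition is_kernel :: "('o, 'm, 'z) preadditive_category_scheme \<Rightarrow> 'm \<Rightarrow> 'm \<Rightarrow> bool" where
  "is_kernel C k f \<longleftrightarrow>
    k \<in> Arr C \<and> f \<in> Arr C \<and> Cod C k = Dom C f \<and>
    f \<cdot>\<^bsub>C\<^esub> k = Zero C (Dom C k) (Cod C f) \<and>
    (\<forall>X\<in>Obj C. \<forall>x\<in>Hom C X (Dom C f). f \<cdot>\<^bsub>C\<^esub> x = Zero C X (Cod C f) \<longrightarrow>
      (\<exists>!u. u \<in> Hom C X (Dom C k) \<and> k \<cdot>\<^bsub>C\<^esub> u = x))"

definition is_cokernel :: "('o, 'm, 'z) preadditive_category_scheme \<Rightarrow> 'm \<Rightarrow> 'm \<Rightarrow> bool" where
  "is_cokernel C d f \<longleftrightarrow>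
    d \<in> Arr C \<and> f \<in> Arr C \<and> Cod C f = Dom C d \<and>
    d \<cdot>\<^bsub>C\<^esub> f = Zero C (Dom C f) (Cod C d) \<and>
    (\<forall>X\<in>Obj C. \<forall>x\<in>Hom C (Cod C f) X. x \<cdot>\<^bsub>C\<^esub> f = Zero C (Dom C f) X \<longrightarrow>
      (\<exists>!u. u \<in> Hom C (Cod C d) X \<and> u \<cdot>\<^bsub>C\<^esub> d = x))"

record ('o, 'm) right_exact_category = "('o, 'm) preadditive_category" +
  Infl :: "'m set"

text \<open>Zero objects and pushouts are unique only up to isomorphism, so the inflation
  axioms about them are required of every zero object and of every pushout.\<close>

locale right_exact_category = additive_category C
  for C :: "('o, 'm, 'z) right_exact_category_scheme" (structure) +
  assumes Infl_is_kernel: "i \<in> Infl C \<Longrightarrow> \<exists>f. is_kernel C i f"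
    and R0: "zero_object C Z \<Longrightarrow> Ident C Z \<in> Infl C"
    and R1: "i \<in> Infl C \<Longrightarrow> j \<in> Infl C \<Longrightarrow> Cod C i = Dom C j \<Longrightarrow> j \<cdot> i \<in> Infl C"
    and R2_exists: "i \<in> Infl C \<Longrightarrow> f \<in> Arr C \<Longrightarrow> Dom C f = Dom C i \<Longrightarrow> \<exists>g j. pushout C i f g j"
    and R2_Infl: "i \<in> Infl C \<Longrightarrow> pushout C i f g j \<Longrightarrow> j \<in> Infl C"

definition conflation :: "('o, 'm, 'z) right_exact_category_scheme \<Rightarrow> 'm \<Rightarrow> 'm \<Rightarrow> bool" where
  "conflation C i d \<longleftrightarrow> i \<in> Infl C \<and> is_cokernel C d i"

end

theory Submission
  imports Defs
begin

text \<open>The direct implication is universal-property bookkeeping: the cokernel of \<open>i\<close> extends by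
  zero over the pushout. For the converse, compare the square with the pushout \<open>(p, j)\<close> of
  \<open>(i, f)\<close>, with vertex \<open>P\<close>, by the induced arrow \<open>h: P \<rightarrow> B'\<close>; it must be shown that \<open>h\<close> is
  invertible although only pushouts of inflations are available. Let \<open>Q\<close> be the pushout of
  \<open>j\<close> and \<open>i'\<close>, with coprojections \<open>a: P \<rightarrow> Q\<close> and \<open>b: B' \<rightarrow> Q\<close>. The arrow \<open>r: Q \<rightarrow> B'\<close>
  induced by \<open>h\<close> and the identity splits \<open>b\<close>, so \<open>Q\<close> is the direct sum of \<open>B'\<close> and the common
  cokernel \<open>X\<close>; in these coordinates \<open>a = (h, d' h)\<close>, and its cokernel is \<open>(y, x) \<mapsto> d' y - x\<close>.
  The inflation \<open>a\<close> is a kernel of that cokernel, and so is the graph \<open>(1, d')\<close> of \<open>d'\<close>; hence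
  \<open>h\<close> is invertible.\<close>

section \<open>Pushout squares in an arbitrary category\<close>

context category
begin

lemma Hom_Obj: "f \<in> Hom C X Y \<Longrightarrow> X \<in> Obj C \<and> Y \<in> Obj C"
  using Dom_closed Cod_closed by (auto simp: Hom_def)

lemma pushout_HomE:
  assumes "pushout C i f g j" "i \<in> Hom C A B" "f \<in> Hom C A A'"
  obtains P where "g \<in> Hom C B P" "j \<in> Hom C A' P"
  using assms by (auto simp: pushout_def Hom_def)

lemma pushout_commute: "pushout C i f g j \<Longrightarrow> g \<cdot> i = j \<cdot> f"
  by (simp add: pushout_def)

lemma pushout_factor:
  assumes "pushout C i f g j" "i \<in> Hom C A B" "f \<in> Hom C A A'" "g \<in> Hom C B P"
    "u \<in> Hom C B X" "v \<in> Hom C A' X" "u \<cdot> i = v \<cdot> f"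
  shows "\<exists>!w. w \<in> Hom C P X \<and> w \<cdot> g = u \<and> w \<cdot> j = v"
proof -
  have "Cod C i = B" "Cod C f = A'" "Cod C g = P" using assms(2-4) by (simp_all add: Hom_def)
  moreover have "X \<in> Obj C" using Hom_Obj[OF assms(5)] by simp
  ultimately show ?thesis using assms(1,5-7) unfolding pushout_def by blast
qed

lemma pushoutI:
  assumes "i \<in> Hom C A B" "f \<in> Hom C A A'" "g \<in> Hom C B P" "j \<in> Hom C A' P" "g \<cdot> i = j \<cdot> f"
    and "\<And>X u v. u \<in> Hom C B X \<Longrightarrow> v \<in> Hom C A' X \<Longrightarrow> u \<cdot> i = v \<cdot> f \<Longrightarrow>
      \<exists>!w. w \<in> Hom C P X \<and> w \<cdot> g = u \<and> w \<cdot> j = v"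
  shows "pushout C i f g j"
proof -
  have "Dom C i = A" "Cod C i = B" "Dom C f = A" "Cod C f = A'" "Dom C g = B" "Cod C g = P"
    "Dom C j = A'" "Cod C j = P" "i \<in> Arr C" "f \<in> Arr C" "g \<in> Arr C" "j \<in> Arr C"
    using assms(1-4) by (simp_all add: Hom_def)
  with assms(5,6) show ?thesis unfolding pushout_def by simp
qed

lemma pushout_sym: "pushout C i f g j \<Longrightarrow> pushout C f i j g"
  unfolding pushout_def by (elim conjE, intro conjI ballI impI) (simp_all add: conj_commute)

text \<open>Both arrows solve the factorization problem posed by the cocone
  \<open>(w \<cdot> g, w \<cdot> j)\<close>, so uniqueness identifies them. Equations between arrows
  out of a pushout are tested this way on the two coprojections.\<close>

lemma pushout_jointly_epic:
  assumes po: "pushout C i f g j" and i: "i \<in> Hom C A B" and f: "f \<in> Hom C A A'"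
    and g: "g \<in> Hom C B P" and j: "j \<in> Hom C A' P"
    and w: "w \<in> Hom C P X" and w': "w' \<in> Hom C P X"
    and eq: "w \<cdot> g = w' \<cdot> g" "w \<cdot> j = w' \<cdot> j"
  shows "w = w'"
proof -
  have "(w \<cdot> g) \<cdot> i = (w \<cdot> j) \<cdot> f"
    using Comp_assoc[OF i g w] Comp_assoc[OF f j w] pushout_commute[OF po] by simp
  from pushout_factor[OF po i f g Comp_closed[OF g w] Comp_closed[OF j w] this]
  show ?thesis using w w' eq by metis
qed

text \<open>A cocone that factors through \<open>P\<close> by \<open>w\<close> factors through
  \<open>Q\<close> by \<open>w \<cdot> m\<close>. This carries the universal property from a
  constructed pushout over to the given square once the comparison arrow has been inverted.\<close>

lemma pushout_iso_vertex:
  assumes po: "pushout C i f p j" and i: "i \<in> Hom C A B" and f: "f \<in> Hom C A A'"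
    and p: "p \<in> Hom C B P" and j: "j \<in> Hom C A' P"
    and h: "h \<in> Hom C P Q" and m: "m \<in> Hom C Q P"
    and mh: "m \<cdot> h = Ident C P" and hm: "h \<cdot> m = Ident C Q"
  shows "pushout C i f (h \<cdot> p) (h \<cdot> j)"
proof (rule pushoutI[OF i f Comp_closed[OF p h] Comp_closed[OF j h]])
  show "(h \<cdot> p) \<cdot> i = (h \<cdot> j) \<cdot> f"
    using Comp_assoc[OF i p h] Comp_assoc[OF f j h] pushout_commute[OF po] by simp
next
  fix X u v assume u: "u \<in> Hom C B X" and v: "v \<in> Hom C A' X" and uv: "u \<cdot> i = v \<cdot> f"
  from pushout_factor[OF po i f p u v uv] obtain w where
    w: "w \<in> Hom C P X" "w \<cdot> p = u" "w \<cdot> j = v" by blast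
  have wm: "w \<cdot> m \<in> Hom C Q X" using Comp_closed[OF m w(1)] .
  have "(w \<cdot> m) \<cdot> h = w" using Comp_assoc[OF h m w(1)] mh Comp_Ident_right[OF w(1)] by simp
  then have ex: "(w \<cdot> m) \<cdot> (h \<cdot> p) = u" "(w \<cdot> m) \<cdot> (h \<cdot> j) = v"
    using Comp_assoc[OF p h wm] Comp_assoc[OF j h wm] w by simp_all
  show "\<exists>!w. w \<in> Hom C Q X \<and> w \<cdot> (h \<cdot> p) = u \<and> w \<cdot> (h \<cdot> j) = v"
  proof (rule ex1I[of _ "w \<cdot> m"])
    fix w' assume w': "w' \<in> Hom C Q X \<and> w' \<cdot> (h \<cdot> p) = u \<and> w' \<cdot> (h \<cdot> j) = v"
    then have w'Q: "w' \<in> Hom C Q X" by simp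
    have "w' \<cdot> h = w"
      by (rule pushout_jointly_epic[OF po i f p j Comp_closed[OF h w'Q] w(1)])
        (use w' w Comp_assoc[OF p h w'Q] Comp_assoc[OF j h w'Q] in simp_all)
    then show "w' = w \<cdot> m"
      using Comp_assoc[OF m h w'Q] hm Comp_Ident_right[OF w'Q] by simp
  qed (use wm ex in simp)
qed

end

section \<open>Hom-groups and zero morphisms\<close>

context preadditive_category
begin

lemma Zero_closed:
  assumes "A \<in> Obj C" "B \<in> Obj C"
  shows "Zero C A B \<in> Hom C A B"
proof -
  interpret G: comm_group "Hom_group C A B" using Hom_comm_group assms by blast
  show ?thesis using G.one_closed assms by (simp add: Hom_group_def)
qed

lemma Add_closed:
  assumes "f \<in> Hom C A B" "g \<in> Hom C A B"
  shows "Add C f g \<in> Hom C A B"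
proof -
  interpret G: comm_group "Hom_group C A B" using Hom_comm_group Hom_Obj[OF assms(1)] by blast
  show ?thesis using G.m_closed[of f g] assms by (simp add: Hom_group_def)
qed

lemma Add_Zero_left:
  assumes "f \<in> Hom C A B"
  shows "Add C (Zero C A B) f = f"
proof -
  interpret G: comm_group "Hom_group C A B" using Hom_comm_group Hom_Obj[OF assms] by blast
  show ?thesis using G.l_one[of f] assms by (simp add: Hom_group_def)
qed

lemma Add_Zero_right:
  assumes "f \<in> Hom C A B"
  shows "Add C f (Zero C A B) = f"
proof -
  interpret G: comm_group "Hom_group C A B" using Hom_comm_group Hom_Obj[OF assms] by blast
  show ?thesis using G.r_one[of f] assms by (simp add: Hom_group_def)
qed

lemma Add_left_eq_self:
  assumes "f \<in> Hom C A B" "g \<in> Hom C A B" "Add C f g = f"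
  shows "g = Zero C A B"
proof -
  interpret G: comm_group "Hom_group C A B" using Hom_comm_group Hom_Obj[OF assms(1)] by blast
  show ?thesis using G.r_cancel_one'[of f g] G.l_cancel_one[of f g] assms
    by (auto simp: Hom_group_def)
qed

lemma Add_commute:
  assumes "f \<in> Hom C A B" "g \<in> Hom C A B"
  shows "Add C f g = Add C g f"
proof -
  interpret G: comm_group "Hom_group C A B" using Hom_comm_group Hom_Obj[OF assms(1)] by blast
  show ?thesis using G.m_comm[of f g] assms by (simp add: Hom_group_def)
qed

text \<open>Stands in for subtraction, as the structure carries only addition and zero:
  \<open>n\<close> is \<open>g - f\<close>, formed with the group inverse.\<close>

lemma Add_solve:
  assumes "f \<in> Hom C A B" "g \<in> Hom C A B"
  obtains n where "n \<in> Hom C A B" "Add C f n = g"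
proof -
  interpret G: comm_group "Hom_group C A B" using Hom_comm_group Hom_Obj[OF assms(1)] by blast
  let ?n = "inv\<^bsub>Hom_group C A B\<^esub> f \<otimes>\<^bsub>Hom_group C A B\<^esub> g"
  have "f \<in> carrier (Hom_group C A B)" "g \<in> carrier (Hom_group C A B)"
    using assms by (simp_all add: Hom_group_def)
  then have "?n \<in> carrier (Hom_group C A B)" "f \<otimes>\<^bsub>Hom_group C A B\<^esub> ?n = g"
    by (auto simp: G.m_assoc[symmetric])
  then show thesis using that by (simp add: Hom_group_def)
qed

lemma Comp_Zero_left:
  assumes f: "f \<in> Hom C X Y" and Z: "Z \<in> Obj C"
  shows "Zero C Y Z \<cdot> f = Zero C X Z"
proof -
  have z: "Zero C Y Z \<in> Hom C Y Z" using Zero_closed Hom_Obj[OF f] Z by blast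
  \<comment> \<open>By bilinearity the composite equals its own double; cancellation in the
    Hom-group then leaves zero.\<close>
  have "Add C (Zero C Y Z \<cdot> f) (Zero C Y Z \<cdot> f) = Zero C Y Z \<cdot> f"
    using Comp_Add_left[OF f z z] Add_Zero_left[OF z] by simp
  then show ?thesis using Add_left_eq_self Comp_closed[OF f z] by blast
qed

lemma Comp_Zero_right:
  assumes f: "f \<in> Hom C Y Z" and X: "X \<in> Obj C"
  shows "f \<cdot> Zero C X Y = Zero C X Z"
proof -
  have z: "Zero C X Y \<in> Hom C X Y" using Zero_closed Hom_Obj[OF f] X by blast
  have "Add C (f \<cdot> Zero C X Y) (f \<cdot> Zero C X Y) = f \<cdot> Zero C X Y"
    using Comp_Add_right[OF z z f] Add_Zero_left[OF z] by simp
  then show ?thesis using Add_left_eq_self Comp_closed[OF z f] by blast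
qed

section \<open>Kernels, cokernels and their behaviour under pushout and splitting\<close>

lemma is_cokernel_zero:
  assumes "is_cokernel C d f" "f \<in> Hom C A B" "d \<in> Hom C B X"
  shows "d \<cdot> f = Zero C A X"
  using assms by (simp add: is_cokernel_def Hom_def)

lemma is_cokernel_factor:
  assumes "is_cokernel C d f" "f \<in> Hom C A B" "d \<in> Hom C B X"
    "x \<in> Hom C B Y" "x \<cdot> f = Zero C A Y"
  obtains u where "u \<in> Hom C X Y" "u \<cdot> d = x"
proof -
  have "Dom C f = A" "Cod C f = B" "Cod C d = X" using assms(2,3) by (simp_all add: Hom_def)
  then show thesis
    using assms(1,4,5) Hom_Obj[OF assms(4)] that unfolding is_cokernel_def by blast
qed

lemma is_cokernel_epic:
  assumes c: "is_cokernel C d f" and f: "f \<in> Hom C A B" and d: "d \<in> Hom C B X"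
    and u: "u \<in> Hom C X Y" and v: "v \<in> Hom C X Y" and eq: "u \<cdot> d = v \<cdot> d"
  shows "u = v"
proof -
  have Y: "Y \<in> Obj C" and A: "A \<in> Obj C" using Hom_Obj u f by auto
  have "(u \<cdot> d) \<cdot> f = Zero C A Y"
    using Comp_assoc[OF f d u] is_cokernel_zero[OF c f d] Comp_Zero_right[OF u A] by simp
  moreover have "u \<cdot> d \<in> Hom C (Cod C f) Y" "Dom C f = A" "Cod C d = X"
    using Comp_closed[OF d u] f d by (auto simp: Hom_def)
  ultimately have "\<exists>!w. w \<in> Hom C X Y \<and> w \<cdot> d = u \<cdot> d"
    using c Y by (simp add: is_cokernel_def)
  then show ?thesis using u v eq by metis
qed

lemma is_cokernelI:
  assumes f: "f \<in> Hom C A B" and d: "d \<in> Hom C B X" and "d \<cdot> f = Zero C A X"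
    and "\<And>Y x. x \<in> Hom C B Y \<Longrightarrow> x \<cdot> f = Zero C A Y \<Longrightarrow> \<exists>!u. u \<in> Hom C X Y \<and> u \<cdot> d = x"
  shows "is_cokernel C d f"
proof -
  have "Dom C f = A" "Cod C f = B" "Dom C d = B" "Cod C d = X" "f \<in> Arr C" "d \<in> Arr C"
    using f d by (auto simp: Hom_def)
  with assms(3,4) show ?thesis by (simp add: is_cokernel_def)
qed

lemma kernel_monic:
  assumes k: "is_kernel C k \<phi>" and kH: "k \<in> Hom C A B"
    and u: "u \<in> Hom C X A" and v: "v \<in> Hom C X A" and eq: "k \<cdot> u = k \<cdot> v"
  shows "u = v"
proof -
  define Y where "Y = Cod C \<phi>"
  have \<phi>: "\<phi> \<in> Hom C B Y" and B: "Dom C \<phi> = B" and A: "Dom C k = A"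
    using k kH by (auto simp: is_kernel_def Hom_def Y_def)
  have X: "X \<in> Obj C" and Y: "Y \<in> Obj C" using Hom_Obj u \<phi> by auto
  have "\<phi> \<cdot> k = Zero C A Y" using k A by (simp add: is_kernel_def Y_def)
  then have "\<phi> \<cdot> (k \<cdot> u) = Zero C X Y"
    using Comp_assoc[OF u kH \<phi>] Comp_Zero_left[OF u Y] by simp
  then have "\<exists>!w. w \<in> Hom C X A \<and> k \<cdot> w = k \<cdot> u"
    using k X Comp_closed[OF u kH] unfolding is_kernel_def A B Y_def by simp
  then show ?thesis using u v eq by metis
qed

text \<open>All that is known of \<open>k\<close> is that it is a kernel of some
  \<open>\<phi>\<close>. Since \<open>\<phi>\<close> kills \<open>k\<close>, it factors as
  \<open>\<psi> \<cdot> d\<close>, so whatever \<open>d\<close> kills is killed by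
  \<open>\<phi>\<close> and lifts through \<open>k\<close>. Together with monicity, this makes an
  inflation a kernel of its own cokernel.\<close>

lemma kernel_factor_cokernel:
  assumes k: "is_kernel C k \<phi>" and kH: "k \<in> Hom C A B"
    and c: "is_cokernel C d k" and d: "d \<in> Hom C B Z"
    and x: "x \<in> Hom C X B" and dx: "d \<cdot> x = Zero C X Z"
  obtains u where "u \<in> Hom C X A" "k \<cdot> u = x"
proof -
  define Y where "Y = Cod C \<phi>"
  have \<phi>: "\<phi> \<in> Hom C B Y" and B: "Dom C \<phi> = B" and A: "Dom C k = A"
    using k kH by (auto simp: is_kernel_def Hom_def Y_def)
  have X: "X \<in> Obj C" using Hom_Obj x by auto
  have "\<phi> \<cdot> k = Zero C A Y" using k A by (simp add: is_kernel_def Y_def)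
  from is_cokernel_factor[OF c kH d \<phi> this] obtain \<psi> where \<psi>: "\<psi> \<in> Hom C Z Y" "\<psi> \<cdot> d = \<phi>" .
  have "\<phi> \<cdot> x = Zero C X Y"
    using Comp_assoc[OF x d \<psi>(1)] \<psi> dx Comp_Zero_right[OF \<psi>(1) X] by simp
  then show thesis
    using k X x that unfolding is_kernel_def A B Y_def by blast
qed

text \<open>The cocone formed by \<open>d\<close> and zero induces \<open>e\<close>. An arrow that
  kills \<open>j\<close> kills \<open>i\<close> after composition with \<open>g\<close>, hence
  factors through \<open>d\<close>; testing on the coprojections turns this into a factorization
  through \<open>e\<close>.\<close>

lemma pushout_cokernel:
  assumes po: "pushout C i f g j" and i: "i \<in> Hom C A B" and f: "f \<in> Hom C A A'"
    and g: "g \<in> Hom C B P" and j: "j \<in> Hom C A' P"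
    and c: "is_cokernel C d i" and d: "d \<in> Hom C B X"
  obtains e where "e \<in> Hom C P X" "e \<cdot> g = d" "is_cokernel C e j"
proof -
  have A: "A \<in> Obj C" and A': "A' \<in> Obj C" and X: "X \<in> Obj C" using Hom_Obj f d by auto
  have "d \<cdot> i = Zero C A' X \<cdot> f"
    using is_cokernel_zero[OF c i d] Comp_Zero_left[OF f X] by simp
  from pushout_factor[OF po i f g d Zero_closed[OF A' X] this]
  obtain e where e: "e \<in> Hom C P X" "e \<cdot> g = d" "e \<cdot> j = Zero C A' X" by blast
  have "is_cokernel C e j"
  proof (rule is_cokernelI[OF j e(1,3)])
    fix Y x assume x: "x \<in> Hom C P Y" and xj: "x \<cdot> j = Zero C A' Y"
    have Y: "Y \<in> Obj C" using Hom_Obj x by auto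
    have "(x \<cdot> g) \<cdot> i = Zero C A Y"
      using Comp_assoc[OF i g x] Comp_assoc[OF f j x] pushout_commute[OF po] xj
        Comp_Zero_left[OF f Y] by simp
    from is_cokernel_factor[OF c i d Comp_closed[OF g x] this]
    obtain u where u: "u \<in> Hom C X Y" "u \<cdot> d = x \<cdot> g" .
    have "u \<cdot> e = x"
      by (rule pushout_jointly_epic[OF po i f g j Comp_closed[OF e(1) u(1)] x])
        (use Comp_assoc[OF g e(1) u(1)] Comp_assoc[OF j e(1) u(1)] e u xj
          Comp_Zero_right[OF u(1) A'] in simp_all)
    moreover have "v = u" if "v \<in> Hom C X Y" "v \<cdot> e = x" for v
      using is_cokernel_epic[OF c i d that(1) u(1)] Comp_assoc[OF g e(1) that(1)] that e u by simp
    ultimately show "\<exists>!u. u \<in> Hom C X Y \<and> u \<cdot> e = x" using u(1) by blast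
  qed
  with e that show thesis by blast
qed

text \<open>The arrow \<open>1 - b \<cdot> r\<close> kills \<open>b\<close>, hence factors through
  the cokernel \<open>e\<close>; the factor \<open>s\<close> is the second injection, and
  \<open>b\<close>, \<open>s\<close>, \<open>r\<close>, \<open>e\<close> exhibit \<open>Q\<close> as
  a biproduct of \<open>B\<close> and \<open>X\<close>.\<close>

lemma split_mono_complement:
  assumes b: "b \<in> Hom C B Q" and r: "r \<in> Hom C Q B" and rb: "r \<cdot> b = Ident C B"
    and c: "is_cokernel C e b" and e: "e \<in> Hom C Q X"
  obtains s where "s \<in> Hom C X Q" "Add C (b \<cdot> r) (s \<cdot> e) = Ident C Q"
    "e \<cdot> s = Ident C X" "r \<cdot> s = Zero C X B"
proof -
  have B: "B \<in> Obj C" and Q: "Q \<in> Obj C" and X: "X \<in> Obj C" using Hom_Obj b e by auto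
  note IX = Ident_closed[OF X]
  have br: "b \<cdot> r \<in> Hom C Q Q" using Comp_closed[OF r b] .
  \<comment> \<open>\<open>n\<close> is the idempotent \<open>1 - b \<cdot> r\<close>.\<close>
  from Add_solve[OF br Ident_closed[OF Q]]
  obtain n where n: "n \<in> Hom C Q Q" "Add C (b \<cdot> r) n = Ident C Q" .
  have brb: "(b \<cdot> r) \<cdot> b = b" using Comp_assoc[OF b r b] rb Comp_Ident_right[OF b] by simp
  have "Add C b (n \<cdot> b) = b"
    using Comp_Add_left[OF b br n(1)] n(2) brb Comp_Ident_left[OF b] by simp
  then have "n \<cdot> b = Zero C B Q" using Add_left_eq_self[OF b Comp_closed[OF b n(1)]] by blast
  from is_cokernel_factor[OF c b e n(1) this]
  obtain s where s: "s \<in> Hom C X Q" "s \<cdot> e = n" .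
  have es: "e \<cdot> s \<in> Hom C X X" and rs: "r \<cdot> s \<in> Hom C X B" using Comp_closed[OF s(1)] e r by auto
  \<comment> \<open>Applying \<open>e\<close>, and later \<open>r\<close>, to the decomposition of
    the identity gives the remaining relations once the epic \<open>e\<close> is cancelled on the
    right.\<close>
  have "e \<cdot> (b \<cdot> r) = Zero C Q X"
    using Comp_assoc[OF r b e] is_cokernel_zero[OF c b e] Comp_Zero_left[OF r X] by simp
  then have "e \<cdot> n = e"
    using Comp_Add_right[OF br n(1) e] n(2) Comp_Ident_right[OF e]
      Add_Zero_left[OF Comp_closed[OF n(1) e]] by simp
  then have "(e \<cdot> s) \<cdot> e = Ident C X \<cdot> e"
    using Comp_assoc[OF e s(1) e] s(2) Comp_Ident_left[OF e] by simp
  then have 1: "e \<cdot> s = Ident C X" by (rule is_cokernel_epic[OF c b e es IX])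
  have "r \<cdot> (b \<cdot> r) = r" using Comp_assoc[OF r b r] rb Comp_Ident_left[OF r] by simp
  then have "Add C r (r \<cdot> n) = r"
    using Comp_Add_right[OF br n(1) r] n(2) Comp_Ident_right[OF r] by simp
  then have "r \<cdot> n = Zero C Q B" using Add_left_eq_self[OF r Comp_closed[OF n(1) r]] by blast
  then have "(r \<cdot> s) \<cdot> e = Zero C X B \<cdot> e"
    using Comp_assoc[OF e s(1) r] s(2) Comp_Zero_left[OF e B] by simp
  then have "r \<cdot> s = Zero C X B"
    by (rule is_cokernel_epic[OF c b e rs Zero_closed[OF X B]])
  with s n 1 that show thesis by simp
qed

end

section \<open>Inflations: existence of cokernels, a short five lemma, and the converse
  implication\<close>

context right_exact_category
begin

text \<open>Push \<open>i\<close> out along the arrow from \<open>A\<close> to a zero object: a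
  cocone there is just an arrow out of \<open>B\<close> that annihilates \<open>i\<close>, its
  component out of the zero object being forced.\<close>

lemma Infl_cokernel:
  assumes i: "i \<in> Infl C" and iH: "i \<in> Hom C A B"
  obtains X d where "d \<in> Hom C B X" "is_cokernel C d i"
proof -
  obtain Z where Z: "zero_object C Z" using zero_object_exists by blast
  have ZO: "Z \<in> Obj C" and A: "A \<in> Obj C" using Z Hom_Obj[OF iH] by (auto simp: zero_object_def)
  have t: "Zero C A Z \<in> Hom C A Z" using Zero_closed[OF A ZO] .
  obtain d j where po: "pushout C i (Zero C A Z) d j"
    using R2_exists[OF i, of "Zero C A Z"] t iH by (auto simp: Hom_def)
  from pushout_HomE[OF po iH t] obtain X where d: "d \<in> Hom C B X" and j: "j \<in> Hom C Z X" .
  have "is_cokernel C d i"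
  proof (rule is_cokernelI[OF iH d])
    show "d \<cdot> i = Zero C A X" using pushout_commute[OF po] Comp_Zero_right[OF j A] by simp
    fix Y x assume x: "x \<in> Hom C B Y" and xi: "x \<cdot> i = Zero C A Y"
    have Y: "Y \<in> Obj C" using Hom_Obj x by auto
    note ZY = Zero_closed[OF ZO Y]
    have ini: "v = w" if "v \<in> Hom C Z Y" "w \<in> Hom C Z Y" for v w
      using Z Y that unfolding zero_object_def by blast
    have "x \<cdot> i = Zero C Z Y \<cdot> Zero C A Z" using xi Comp_Zero_left[OF t Y] by simp
    from pushout_factor[OF po iH t d x ZY this]
    have ex: "\<exists>!w. w \<in> Hom C X Y \<and> w \<cdot> d = x \<and> w \<cdot> j = Zero C Z Y" .
    have "w \<cdot> j = Zero C Z Y" if "w \<in> Hom C X Y" for w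
      using ini[OF Comp_closed[OF j that] ZY] .
    with ex show "\<exists>!u. u \<in> Hom C X Y \<and> u \<cdot> d = x" by metis
  qed
  with d that show thesis by blast
qed

text \<open>This inverts the comparison arrow. Here \<open>A\<close>, \<open>i\<close>,
  \<open>B\<close>, \<open>d\<close> are the \<open>A'\<close>, \<open>i'\<close>,
  \<open>B'\<close>, \<open>d'\<close> of the opening outline, and \<open>r\<close>,
  \<open>e\<close> serve as coordinates \<open>(y, x)\<close> on \<open>Q\<close>.\<close>

lemma short_five_lemma:
  assumes j: "j \<in> Infl C" and jH: "j \<in> Hom C A P" and i: "i \<in> Infl C" and iH: "i \<in> Hom C A B"
    and h: "h \<in> Hom C P B" and hj: "h \<cdot> j = i"
    and c: "is_cokernel C d i" and d: "d \<in> Hom C B X" and ch: "is_cokernel C (d \<cdot> h) j"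
  obtains m where "m \<in> Hom C B P" "m \<cdot> h = Ident C P" "h \<cdot> m = Ident C B"
proof -
  have B: "B \<in> Obj C" and P: "P \<in> Obj C" and X: "X \<in> Obj C" using Hom_Obj h d by auto
  have dh: "d \<cdot> h \<in> Hom C P X" using Comp_closed[OF h d] .
  obtain a b where po: "pushout C j i a b" using R2_exists[OF j, of i] jH iH by (auto simp: Hom_def)
  \<comment> \<open>The square is read both ways: as a pushout of \<open>j\<close> it gives
    \<open>b\<close> a cokernel \<open>e\<close> with \<open>e \<cdot> a = d \<cdot> h\<close>; as a
    pushout of \<open>i\<close> it makes \<open>a\<close> an inflation with a cokernel
    \<open>e'\<close> extending \<open>d\<close>.\<close>
  note po' = pushout_sym[OF po]
  from pushout_HomE[OF po jH iH] obtain Q where a: "a \<in> Hom C P Q" and b: "b \<in> Hom C B Q" .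
  have "a \<in> Infl C" using R2_Infl[OF i po'] .
  then obtain \<phi> where ker: "is_kernel C a \<phi>" using Infl_is_kernel by blast
  from pushout_cokernel[OF po jH iH a b ch dh]
  obtain e where e: "e \<in> Hom C Q X" "e \<cdot> a = d \<cdot> h" and ce: "is_cokernel C e b" .
  from pushout_cokernel[OF po' iH jH b a c d]
  obtain e' where e': "e' \<in> Hom C Q X" "e' \<cdot> b = d" and ce': "is_cokernel C e' a" .
  have "h \<cdot> j = Ident C B \<cdot> i" using hj Comp_Ident_left[OF iH] by simp
  from pushout_factor[OF po jH iH a h Ident_closed[OF B] this]
  obtain r where r: "r \<in> Hom C Q B" "r \<cdot> a = h" "r \<cdot> b = Ident C B" by blast
  from split_mono_complement[OF b r(1,3) ce e(1)]
  obtain s where s: "s \<in> Hom C X Q" "Add C (b \<cdot> r) (s \<cdot> e) = Ident C Q"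
    "e \<cdot> s = Ident C X" "r \<cdot> s = Zero C X B" .
  \<comment> \<open>The next equation is the formula \<open>(y, x) |-> d y - x\<close> for
    \<open>e'\<close>, with the negative term moved across.\<close>
  note dr = Comp_closed[OF r(1) d] and sd = Comp_closed[OF d s(1)]
  have sum: "Add C e' e = d \<cdot> r"
  proof (rule pushout_jointly_epic[OF po jH iH a b Add_closed[OF e'(1) e(1)] dr])
    show "Add C e' e \<cdot> a = (d \<cdot> r) \<cdot> a"
      using Comp_Add_left[OF a e'(1) e(1)] is_cokernel_zero[OF ce' a e'(1)] e(2)
        Add_Zero_left[OF dh] Comp_assoc[OF a r(1) d] r(2) by simp
    show "Add C e' e \<cdot> b = (d \<cdot> r) \<cdot> b"
      using Comp_Add_left[OF b e'(1) e(1)] is_cokernel_zero[OF ce b e(1)] e'(2)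
        Add_Zero_right[OF d] Comp_assoc[OF b r(1) d] r(3) Comp_Ident_right[OF d] by simp
  qed
  have e's: "e' \<cdot> s \<in> Hom C X X" using Comp_closed[OF s(1) e'(1)] .
  \<comment> \<open>Restricting that equation to the summand \<open>X\<close> says that
    \<open>e' \<cdot> s\<close> is minus the identity.\<close>
  have "(d \<cdot> r) \<cdot> s = Zero C X X"
    using Comp_assoc[OF s(1) r(1) d] s(4) Comp_Zero_right[OF d X] by simp
  then have "Add C (e' \<cdot> s) (Ident C X) = Zero C X X"
    using Comp_Add_left[OF s(1) e'(1) e(1)] sum s(3) by simp
  then have neg: "Add C (Ident C X) (e' \<cdot> s) = Zero C X X"
    using Add_commute[OF e's Ident_closed[OF X]] by simp
  \<comment> \<open>The graph \<open>y |-> (y, d y)\<close> of \<open>d\<close>. It is killed by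
    \<open>e'\<close>, so it lifts through \<open>a\<close>, and the lift \<open>m\<close> is the
    candidate inverse of \<open>h\<close>.\<close>
  define k where "k = Add C b (s \<cdot> d)"
  have kH: "k \<in> Hom C B Q" unfolding k_def using Add_closed[OF b sd] .
  have "e' \<cdot> k = Add C d ((e' \<cdot> s) \<cdot> d)"
    unfolding k_def using Comp_Add_right[OF b sd e'(1)] e'(2) Comp_assoc[OF d s(1) e'(1)] by simp
  also have "\<dots> = Add C (Ident C X) (e' \<cdot> s) \<cdot> d"
    using Comp_Add_left[OF d Ident_closed[OF X] e's] Comp_Ident_left[OF d] by simp
  finally have "e' \<cdot> k = Zero C B X" using neg Comp_Zero_left[OF d X] by simp
  from kernel_factor_cokernel[OF ker a ce' e'(1) kH this]
  obtain m where m: "m \<in> Hom C B P" "a \<cdot> m = k" .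
  have "r \<cdot> k = Ident C B"
    unfolding k_def using Comp_Add_right[OF b sd r(1)] r(3) Comp_assoc[OF d s(1) r(1)] s(4)
      Comp_Zero_left[OF d B] Add_Zero_right[OF Ident_closed[OF B]] by simp
  then have hm: "h \<cdot> m = Ident C B" using Comp_assoc[OF m(1) a r(1)] r(2) m(2) by simp
  \<comment> \<open>Precomposed with \<open>h\<close>, the graph becomes \<open>(h, d h)\<close>,
    which is \<open>a\<close> itself; monicity of \<open>a\<close> then yields the other inverse
    law.\<close>
  have "k \<cdot> h = Add C (b \<cdot> h) ((s \<cdot> d) \<cdot> h)"
    unfolding k_def using Comp_Add_left[OF h b sd] .
  also have "\<dots> = Add C ((b \<cdot> r) \<cdot> a) ((s \<cdot> e) \<cdot> a)"
    using Comp_assoc[OF a r(1) b] r(2) Comp_assoc[OF a e(1) s(1)] e(2) Comp_assoc[OF h d s(1)]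
    by simp
  also have "\<dots> = a"
    using Comp_Add_left[OF a Comp_closed[OF r(1) b] Comp_closed[OF e(1) s(1)]] s(2)
      Comp_Ident_left[OF a] by simp
  finally have "a \<cdot> (m \<cdot> h) = a \<cdot> Ident C P"
    using Comp_assoc[OF h m(1) a] m(2) Comp_Ident_right[OF a] by simp
  then have "m \<cdot> h = Ident C P"
    using kernel_monic[OF ker a Comp_closed[OF h m(1)] Ident_closed[OF P]] by blast
  with m hm that show thesis by blast
qed

lemma pushout_if_same_cokernel:
  assumes i: "i \<in> Infl C" and iH: "i \<in> Hom C A B" and i': "i' \<in> Infl C" and i'H: "i' \<in> Hom C A' B'"
    and f: "f \<in> Hom C A A'" and g: "g \<in> Hom C B B'" and comm: "g \<cdot> i = i' \<cdot> f"
    and c: "is_cokernel C d i" and d: "d \<in> Hom C B X"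
    and c': "is_cokernel C d' i'" and d': "d' \<in> Hom C B' X" and d'g: "d' \<cdot> g = d"
  shows "pushout C i f g i'"
proof -
  obtain p j where po: "pushout C i f p j" using R2_exists[OF i, of f] iH f by (auto simp: Hom_def)
  from pushout_HomE[OF po iH f] obtain P where p: "p \<in> Hom C B P" and j: "j \<in> Hom C A' P" .
  from pushout_factor[OF po iH f p g i'H comm]
  obtain h where h: "h \<in> Hom C P B'" "h \<cdot> p = g" "h \<cdot> j = i'" by blast
  from pushout_cokernel[OF po iH f p j c d]
  obtain e where e: "e \<in> Hom C P X" "e \<cdot> p = d" "is_cokernel C e j" .
  \<comment> \<open>Both arrows restrict to \<open>d\<close> along \<open>p\<close> and to zero
    along \<open>j\<close>. Hence \<open>d' \<cdot> h\<close> is a cokernel of \<open>j\<close>, as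
    the short five lemma requires.\<close>
  have "d' \<cdot> h = e"
    by (rule pushout_jointly_epic[OF po iH f p j Comp_closed[OF h(1) d'] e(1)])
      (use Comp_assoc[OF p h(1) d'] Comp_assoc[OF j h(1) d'] h e d'g is_cokernel_zero[OF c' i'H d']
        is_cokernel_zero[OF e(3) j e(1)] in simp_all)
  with e have "is_cokernel C (d' \<cdot> h) j" by simp
  from short_five_lemma[OF R2_Infl[OF i po] j i' i'H h(1,3) c' d' this]
  obtain m where "m \<in> Hom C B' P" "m \<cdot> h = Ident C P" "h \<cdot> m = Ident C B'" .
  from pushout_iso_vertex[OF po iH f p j h(1) this] show ?thesis using h by simp
qed

end

theorem proposition5p4:
  fixes C :: "('o, 'm, 'z) right_exact_category_scheme" (structure)
    and A B A' B' :: 'o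
    and i i' f g :: 'm
  assumes "right_exact_category C"
    and "i \<in> Infl C" and "i \<in> Hom C A B"
    and "i' \<in> Infl C" and "i' \<in> Hom C A' B'"
    and "f \<in> Hom C A A'" and "g \<in> Hom C B B'"
    and "g \<cdot> i = i' \<cdot> f"
  shows "pushout C i f g i' \<longleftrightarrow>
    (\<exists>X\<in>Obj C. \<exists>d\<in>Hom C B X. \<exists>d'\<in>Hom C B' X.
      conflation C i d \<and> conflation C i' d' \<and>
      g \<cdot> i = i' \<cdot> f \<and> d' \<cdot> g = Ident C X \<cdot> d)"
proof -
  interpret right_exact_category C by fact
  show ?thesis
  proof
    assume po: "pushout C i f g i'"
    from Infl_cokernel[OF assms(2,3)]
    obtain X d where d: "d \<in> Hom C B X" "is_cokernel C d i" .
    \<comment> \<open>The cokernel of \<open>i'\<close> obtained here has the same codomain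
      \<open>X\<close>, so the third vertical arrow is the identity.\<close>
    from pushout_cokernel[OF po assms(3,6,7,5) d(2,1)]
    obtain d' where "d' \<in> Hom C B' X" "d' \<cdot> g = d" "is_cokernel C d' i'" .
    with d assms Comp_Ident_left[OF d(1)] Hom_Obj[OF d(1)]
    show "\<exists>X\<in>Obj C. \<exists>d\<in>Hom C B X. \<exists>d'\<in>Hom C B' X.
      conflation C i d \<and> conflation C i' d' \<and> g \<cdot> i = i' \<cdot> f \<and> d' \<cdot> g = Ident C X \<cdot> d"
      unfolding conflation_def by metis
  next
    assume "\<exists>X\<in>Obj C. \<exists>d\<in>Hom C B X. \<exists>d'\<in>Hom C B' X.
      conflation C i d \<and> conflation C i' d' \<and> g \<cdot> i = i' \<cdot> f \<and> d' \<cdot> g = Ident C X \<cdot> d"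
    then obtain X d d' where "d \<in> Hom C B X" "d' \<in> Hom C B' X"
      "is_cokernel C d i" "is_cokernel C d' i'" "d' \<cdot> g = Ident C X \<cdot> d"
      unfolding conflation_def by blast
    then show "pushout C i f g i'"
      using pushout_if_same_cokernel[OF assms(2-8)] Comp_Ident_left by metis
  qed
qed

end
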